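(* Let $\phi:(\mathbb{P}^1)^3\dashrightarrow\mathbb{P}^3$ be a hexahedral trilinear rational map. Then $\phi$ is birational of type $(1,1,1)$ if and only if the $2\times 2\times 2$ tensor $$W=\left(\frac{w_{ijk}}{\Delta_{ijk}}\right)_{0\le i,j,k\le 1}$$ has rank one.
   Context: Setting. $\mathbb{P}^n$ is complex projective $n$-space. $\phi:\mathbb{P}^1\times\mathbb{P}^1\times\mathbb{P}^1\dashrightarrow\mathbb{P}^3$ is the trilinear rational map given by $$\mathbf{f}=(f_0,f_1,f_2,f_3)=\sum_{0\le i,j,k\le 1} w_{ijk}\,\mathbf{P}_{ijk}\,s_it_ju_k,$$ with control points $\mathbf{P}_{ijk}=(1,x_{ijk},y_{ijk},z_{ijk})\in\mathbb{R}^4$ (identified with points of $\mathbb{P}^3$) and weights $w_{ijk}\in\mathbb{R}$; $(s_0:s_1),(t_0:t_1),(u_0:u_1)$ are the coordinates on the three factors. Boundary surfaces. $\Sigma_0$ (resp. $\Sigma_1$) is the closure of the image of $\phi$ restricted to $(s_0:s_1)=(1:0)$ (resp. $(0:1)$). $T_0,T_1$ and $Y_0,Y_1$ are defined in the same way using $(t_0:t_1)$ and $(u_0:u_1)$. So $\mathbf{P}_{ijk}\in\Sigma_i\cap T_j\cap Y_k$. Boundary lines: $s_{jk}$ is the image of the line where $t$ and $u$ are fixed at the $j$-th and $k$-th coordinate points (it joins $\mathbf{P}_{0jk},\mathbf{P}_{1jk}$); likewise $t_{ik}$ joins $\mathbf{P}_{i0k},\mathbf{P}_{i1k}$ and $u_{ij}$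 joins $\mathbf{P}_{ij0},\mathbf{P}_{ij1}$. Each boundary surface is either a plane or a quadric. Standing nondegeneracy assumption: the surfaces $\Sigma_i,T_j,Y_k$ are smooth surfaces, pairwise distinct, and $s_{jk},t_{ik},u_{ij}$ are lines, pairwise distinct, for all $0\le i,j,k\le1$. $\phi$ is hexahedral if all boundary surfaces are planes. Then $\Sigma_i,T_j,Y_k$ are defined by linear forms with coefficient vectors $\boldsymbol{\sigma}_i=(\sigma_{0i},\sigma_{1i},\sigma_{2i},\sigma_{3i})$, $\boldsymbol{\tau}_j=(\tau_{0j},\dots,\tau_{3j})$, $\boldsymbol{\upsilon}_k=(\upsilon_{0k},\dots,\upsilon_{3k})$ in $\mathbb{R}^4$, and $$\Delta_{ijk}=\begin{vmatrix}\sigma_{1i}&\sigma_{2i}&\sigma_{3i}\\ \tau_{1j}&\tau_{2j}&\tau_{3j}\\ \upsilon_{1k}&\upsilon_{2k}&\upsilon_{3k}\end{vmatrix},$$ which is nonzero, with $\mathbf{P}_{ijk}=\Delta_{ijk}^{-1}\,\boldsymbol{\sigma}_i\wedge\boldsymbol{\tau}_j\wedge\boldsymbol{\upsilon}_k$ (the triple wedge being identified with a vector of $\mathbb{R}^4$). Type. If $\phi$ is birational, its inverse is $\mathbf{x}\mapsto(A_0:A_1)\times(B_0:B_1)\times(C_0:C_1)$ with $A_0,A_1$ (resp. $B_0,B_1$; $C_0,C_1$) homogeneous of the same degree in $\mathbf{x}=(x_0,x_1,x_2,x_3)$ without common factor; the type of $\phi$ is $(\deg A_i,\deg B_j,\deg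 C_k)$. A tensor has rank one if it equals $\boldsymbol{\alpha}\otimes\boldsymbol{\beta}\otimes\boldsymbol{\gamma}$ with nonzero vectors. *)

theory Defs
  imports "HOL-Analysis.Analysis" "HOL-Library.Poly_Mapping"
begin

text \<open>
  Complex projective space of dimension \<open>n\<close> is handled through homogeneous coordinates: a point is
  given by a nonzero vector of \<^typ>\<open>complex ^ 'n\<close> with \<open>CARD('n) = n + 1\<close>, and a subset is given
  by the set of \<^emph>\<open>all\<close> homogeneous coordinate vectors of its points, that is, by a subset of
  \<open>UNIV - {0}\<close> that is stable under nonzero scaling. Two subsets of projective space are then equal
  iff these sets of vectors are. Coordinates are indexed by the numeral types \<open>2 = {0, 1}\<close> and
  \<open>4 = {0, 1, 2, 3}\<close>.
\<close>

definition same_point :: "complex ^ 'n \<Rightarrow> complex ^ 'n \<Rightarrow> bool" where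
  "same_point x y \<longleftrightarrow> x \<noteq> 0 \<and> y \<noteq> 0 \<and> (\<exists>c. c \<noteq> 0 \<and> x = c *s y)"

definition points_of :: "(complex ^ 'n) set \<Rightarrow> (complex ^ 'n) set" where
  "points_of S = {x. \<exists>y\<in>S. same_point x y}"

text \<open>Polynomials in variables indexed by \<open>'n\<close>: finitely supported maps from exponents to coefficients.\<close>

type_synonym 'n cpoly = "('n \<Rightarrow>\<^sub>0 nat) \<Rightarrow>\<^sub>0 complex"

definition peval :: "'n::finite cpoly \<Rightarrow> complex ^ 'n \<Rightarrow> complex" where
  "peval F x = (\<Sum>m\<in>Poly_Mapping.keys F.
      Poly_Mapping.lookup F m * (\<Prod>i\<in>UNIV. (x $ i) ^ Poly_Mapping.lookup m i))"

definition homogeneous :: "nat \<Rightarrow> 'n::finite cpoly \<Rightarrow> bool" where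
  "homogeneous d F \<longleftrightarrow>
     (\<forall>m\<in>Poly_Mapping.keys F. (\<Sum>i\<in>UNIV. Poly_Mapping.lookup m i) = d)"

definition no_common_factor :: "'n::finite cpoly \<Rightarrow> 'n cpoly \<Rightarrow> bool" where
  "no_common_factor F G \<longleftrightarrow> (\<forall>D. D dvd F \<longrightarrow> D dvd G \<longrightarrow> D dvd 1)"

definition zariski_closure :: "(complex ^ 'n) set \<Rightarrow> (complex ^ 'n) set" where
  "zariski_closure S =
     {x. x \<noteq> 0 \<and> (\<forall>d F. homogeneous d F \<and> (\<forall>y\<in>S. peval F y = 0) \<longrightarrow> peval F x = 0)}"

text \<open>Smoothness of a surface in projective 3-space is the Jacobian criterion for a defining form.\<close>

definition smooth_surface :: "(complex ^ 4) set \<Rightarrow> bool" where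
  "smooth_surface S \<longleftrightarrow>
     (\<exists>d F. 0 < d \<and> homogeneous d F \<and> S = {x. x \<noteq> 0 \<and> peval F x = 0} \<and>
        (\<forall>x\<in>S. \<exists>i. deriv (\<lambda>h. peval F (x + h *s axis i 1)) 0 \<noteq> 0))"

definition plane_of :: "complex ^ 4 \<Rightarrow> (complex ^ 4) set" where
  "plane_of a = {x. x \<noteq> 0 \<and> (\<Sum>l\<in>UNIV. a $ l * x $ l) = 0}"

definition is_plane :: "(complex ^ 4) set \<Rightarrow> bool" where
  "is_plane S \<longleftrightarrow> (\<exists>a. a \<noteq> 0 \<and> S = plane_of a)"

definition is_line :: "(complex ^ 4) set \<Rightarrow> bool" where
  "is_line S \<longleftrightarrow> (\<exists>L. vec.subspace L \<and> vec.dim L = 2 \<and> S = L - {0})"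

definition cvec :: "real ^ 'n \<Rightarrow> complex ^ 'n" where
  "cvec v = (\<chi> i. complex_of_real (v $ i))"

text \<open>
  A rational map from the triple product of the projective line to projective 3-space is given by
  its tuple of defining forms, as a function of the homogeneous coordinates on the three factors;
  where the tuple vanishes the map is considered undefined.
\<close>

type_synonym trimap = "complex ^ 2 \<Rightarrow> complex ^ 2 \<Rightarrow> complex ^ 2 \<Rightarrow> complex ^ 4"

definition trilinear_map ::
    "(2 \<Rightarrow> 2 \<Rightarrow> 2 \<Rightarrow> real ^ 4) \<Rightarrow> (2 \<Rightarrow> 2 \<Rightarrow> 2 \<Rightarrow> real) \<Rightarrow> trimap" where
  "trilinear_map P w s t u =
     (\<Sum>i\<in>UNIV. \<Sum>j\<in>UNIV. \<Sum>k\<in>UNIV.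
        (complex_of_real (w i j k) * s $ i * t $ j * u $ k) *s cvec (P i j k))"

text \<open>The coordinate point \<open>(1:0)\<close> is \<open>axis 0 1\<close> and \<open>(0:1)\<close> is \<open>axis 1 1\<close>.\<close>

definition surface_s :: "trimap \<Rightarrow> 2 \<Rightarrow> (complex ^ 4) set" where
  "surface_s f i = zariski_closure (points_of {f (axis i 1) t u | t u. t \<noteq> 0 \<and> u \<noteq> 0})"

definition surface_t :: "trimap \<Rightarrow> 2 \<Rightarrow> (complex ^ 4) set" where
  "surface_t f j = zariski_closure (points_of {f s (axis j 1) u | s u. s \<noteq> 0 \<and> u \<noteq> 0})"

definition surface_u :: "trimap \<Rightarrow> 2 \<Rightarrow> (complex ^ 4) set" where
  "surface_u f k = zariski_closure (points_of {f s t (axis k 1) | s t. s \<noteq> 0 \<and> t \<noteq> 0})"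

definition line_s :: "trimap \<Rightarrow> 2 \<Rightarrow> 2 \<Rightarrow> (complex ^ 4) set" where
  "line_s f j k = points_of {f s (axis j 1) (axis k 1) | s. s \<noteq> 0}"

definition line_t :: "trimap \<Rightarrow> 2 \<Rightarrow> 2 \<Rightarrow> (complex ^ 4) set" where
  "line_t f i k = points_of {f (axis i 1) t (axis k 1) | t. t \<noteq> 0}"

definition line_u :: "trimap \<Rightarrow> 2 \<Rightarrow> 2 \<Rightarrow> (complex ^ 4) set" where
  "line_u f i j = points_of {f (axis i 1) (axis j 1) u | u. u \<noteq> 0}"

definition boundary_surfaces :: "trimap \<Rightarrow> (complex ^ 4) set list" where
  "boundary_surfaces f =
     [surface_s f 0, surface_s f 1, surface_t f 0, surface_t f 1, surface_u f 0, surface_u f 1]"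

definition boundary_lines :: "trimap \<Rightarrow> (complex ^ 4) set list" where
  "boundary_lines f =
     [line_s f 0 0, line_s f 0 1, line_s f 1 0, line_s f 1 1,
      line_t f 0 0, line_t f 0 1, line_t f 1 0, line_t f 1 1,
      line_u f 0 0, line_u f 0 1, line_u f 1 0, line_u f 1 1]"

definition nondegenerate :: "trimap \<Rightarrow> bool" where
  "nondegenerate f \<longleftrightarrow>
     (\<forall>S\<in>set (boundary_surfaces f). smooth_surface S) \<and> distinct (boundary_surfaces f) \<and>
     (\<forall>l\<in>set (boundary_lines f). is_line l) \<and> distinct (boundary_lines f)"

definition hexahedral :: "trimap \<Rightarrow> bool" where
  "hexahedral f \<longleftrightarrow> (\<forall>S\<in>set (boundary_surfaces f). is_plane S)"

text \<open>A pair of forms \<open>A 0, A 1\<close> of the same degree, evaluated in homogeneous coordinates.\<close>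

definition eval_pair :: "(2 \<Rightarrow> 4 cpoly) \<Rightarrow> complex ^ 4 \<Rightarrow> complex ^ 2" where
  "eval_pair A x = (\<chi> i. peval (A i) x)"

text \<open>
  \<open>f\<close> and \<open>x \<mapsto> (A 0 : A 1) \<times> (B 0 : B 1) \<times> (C 0 : C 1)\<close> are mutually inverse rational maps: both
  compositions are defined somewhere (hence on a dense Zariski open set, as the sources are
  irreducible), and equal the identity wherever they are defined.
\<close>

definition inverse_rational_maps ::
    "trimap \<Rightarrow> (2 \<Rightarrow> 4 cpoly) \<Rightarrow> (2 \<Rightarrow> 4 cpoly) \<Rightarrow> (2 \<Rightarrow> 4 cpoly) \<Rightarrow> bool" where
  "inverse_rational_maps f A B C \<longleftrightarrow>
     (let D = (\<lambda>x. x \<noteq> 0 \<and> eval_pair A x \<noteq> 0 \<and> eval_pair B x \<noteq> 0 \<and> eval_pair C x \<noteq> 0);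
          E = (\<lambda>s t u. s \<noteq> 0 \<and> t \<noteq> 0 \<and> u \<noteq> 0 \<and> f s t u \<noteq> 0)
      in (\<exists>s t u. E s t u \<and> D (f s t u)) \<and>
         (\<forall>s t u. E s t u \<and> D (f s t u) \<longrightarrow>
            same_point (eval_pair A (f s t u)) s \<and>
            same_point (eval_pair B (f s t u)) t \<and>
            same_point (eval_pair C (f s t u)) u) \<and>
         (\<exists>x. D x \<and> E (eval_pair A x) (eval_pair B x) (eval_pair C x)) \<and>
         (\<forall>x. D x \<and> E (eval_pair A x) (eval_pair B x) (eval_pair C x) \<longrightarrow>
            same_point (f (eval_pair A x) (eval_pair B x) (eval_pair C x)) x))"

definition birational_of_type :: "trimap \<Rightarrow> nat \<times> nat \<times> nat \<Rightarrow> bool" where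
  "birational_of_type f = (\<lambda>(a, b, c). \<exists>A B C.
     (\<forall>i. homogeneous a (A i)) \<and> no_common_factor (A 0) (A 1) \<and>
     (\<forall>i. homogeneous b (B i)) \<and> no_common_factor (B 0) (B 1) \<and>
     (\<forall>i. homogeneous c (C i)) \<and> no_common_factor (C 0) (C 1) \<and>
     inverse_rational_maps f A B C)"

text \<open>The minor on the coordinates 1, 2, 3, leaving out the homogenizing coordinate 0.\<close>

definition Delta :: "real ^ 4 \<Rightarrow> real ^ 4 \<Rightarrow> real ^ 4 \<Rightarrow> real" where
  "Delta a b c = det (vector [vector [a $ 1, a $ 2, a $ 3],
                              vector [b $ 1, b $ 2, b $ 3],
                              vector [c $ 1, c $ 2, c $ 3]] :: real ^ 3 ^ 3)"

definition rank_one :: "(2 \<Rightarrow> 2 \<Rightarrow> 2 \<Rightarrow> real) \<Rightarrow> bool" where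
  "rank_one W \<longleftrightarrow> (\<exists>\<alpha> \<beta> \<gamma> :: real ^ 2. \<alpha> \<noteq> 0 \<and> \<beta> \<noteq> 0 \<and> \<gamma> \<noteq> 0 \<and>
     (\<forall>i j k. W i j k = \<alpha> $ i * \<beta> $ j * \<gamma> $ k))"

end

theory Submission
  imports Defs
begin

text \<open>
  Every vertex is the intersection of its three boundary planes, so it is proportional to their
  wedge product, with factor \<open>\<Delta>\<close>, and the map is \<open>\<Sum> W\<^sub>i\<^sub>j\<^sub>k s\<^sub>i t\<^sub>j u\<^sub>k \<sigma>\<^sub>i \<and> \<tau>\<^sub>j \<and> \<upsilon>\<^sub>k\<close>.

  If \<open>W = \<alpha> \<otimes> \<beta> \<otimes> \<gamma>\<close>, this is the wedge product of \<open>\<Sum> \<alpha>\<^sub>i s\<^sub>i \<sigma>\<^sub>i\<close> and its two analogues, that is, the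
  intersection of one plane from each of three pencils. The inverse sends a point to the members of
  the pencils through it: \<open>s = (\<alpha>\<^sub>1 \<sigma>\<^sub>1(x) : - \<alpha>\<^sub>0 \<sigma>\<^sub>0(x))\<close>.

  Conversely, for an inverse of type \<open>(1, 1, 1)\<close> the identity \<open>s\<^sub>1 A\<^sub>0(f) = s\<^sub>0 A\<^sub>1(f)\<close> holds everywhere by
  density. At \<open>s = (1:0)\<close> and \<open>(0:1)\<close> it makes \<open>A\<^sub>1\<close> a multiple of \<open>\<sigma>\<^sub>0\<close> and \<open>A\<^sub>0\<close> a multiple of \<open>\<sigma>\<^sub>1\<close>; the
  coefficient of \<open>s\<^sub>0 s\<^sub>1\<close> then says that the slices \<open>W\<^sub>0\<^sub>j\<^sub>k\<close> and \<open>W\<^sub>1\<^sub>j\<^sub>k\<close> are proportional. The same in all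
  three directions means rank one.
\<close>

section \<open>Wedge products in dimension four\<close>

lemma UNIV_4: "(UNIV :: 4 set) = {0, 1, 2, 3}"
proof -
  have "card {0, 1, 2, 3 :: 4} = card (UNIV :: 4 set)"
    by simp
  then show ?thesis
    by (metis card_subset_eq finite_class.finite_UNIV subset_UNIV)
qed

lemma forall_4: "(\<forall>l::4. R l) \<longleftrightarrow> R 0 \<and> R 1 \<and> R 2 \<and> R 3"
proof -
  have "(\<forall>l::4. R l) \<longleftrightarrow> (\<forall>l\<in>{0,1,2,3}. R l)"
    by (simp flip: UNIV_4)
  then show ?thesis by simp
qed

lemma sum_4: "sum g (UNIV :: 4 set) = g 0 + g 1 + g 2 + (g 3 :: 'a::comm_monoid_add)"
  unfolding UNIV_4 by (simp add: add.assoc)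

lemma UNIV_two: "(UNIV :: 2 set) = {0, 1}"
  using UNIV_2 by auto

lemma forall_two: "(\<forall>i::2. R i) \<longleftrightarrow> R 0 \<and> R 1"
  using UNIV_two by (metis UNIV_I empty_iff insert_iff)

lemma two_neq_cases: "(i :: 2) \<noteq> j \<Longrightarrow> i = 0 \<and> j = 1 \<or> i = 1 \<and> j = 0"
  by (metis UNIV_I UNIV_two empty_iff insert_iff)

lemma sum_two: "sum g (UNIV :: 2 set) = g 0 + (g 1 :: 'a::comm_monoid_add)"
  unfolding UNIV_two by simp

text \<open>Bilinear rather than Hermitian: it is the value of a linear form at a point, so its
  vanishing stays an algebraic condition over any ring.\<close>

definition dot :: "'a::comm_ring_1 ^ 'n \<Rightarrow> 'a ^ 'n \<Rightarrow> 'a" where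
  "dot a x = (\<Sum>l\<in>UNIV. a $ l * x $ l)"

lemma dot_simps [simp]:
  "dot (a + b) x = dot a x + dot b x" "dot a (x + y) = dot a x + dot a y"
  "dot (c *s a) x = c * dot a x" "dot a (c *s x) = c * dot a x"
  "dot 0 x = 0" "dot a 0 = 0" "dot (- a) x = - dot a x" "dot a (- x) = - dot a x"
  by (simp_all add: dot_def algebra_simps sum.distrib sum_distrib_left sum_negf)

lemma dot_axis [simp]: "dot a (axis p 1) = a $ p"
  by (simp add: dot_def axis_def if_distrib sum.delta cong: if_cong)

text \<open>Vanishing of all 2x2 minors. Unlike \<open>same_point\<close> this admits zero vectors,
  so it can be derived from identities without case distinctions.\<close>

definition parallel :: "'a::comm_ring_1 ^ 'n \<Rightarrow> 'a ^ 'n \<Rightarrow> bool" where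
  "parallel a b \<longleftrightarrow> (\<forall>p q. a $ p * b $ q = a $ q * b $ p)"

lemma parallel_commute: "parallel a b \<longleftrightarrow> parallel b a"
  unfolding parallel_def by (metis mult.commute)

lemma parallel_smult [simp]: "parallel (c *s a) a" "parallel a (c *s a)" "parallel 0 a" "parallel a 0"
  by (auto simp: parallel_def)

lemma parallelE:
  fixes a b :: "'a::field ^ 'n"
  assumes "parallel a b" "b \<noteq> 0"
  obtains c where "a = c *s b"
proof -
  obtain p where p: "b $ p \<noteq> 0" using assms(2) by (auto simp: vec_eq_iff)
  have "a = (a $ p / b $ p) *s b"
    using assms(1) p by (auto simp: vec_eq_iff parallel_def field_simps)
  then show ?thesis using that by blast
qed

lemma parallel_trans:
  fixes a b c :: "'a::field ^ 'n"
  assumes "parallel a b" "parallel b c" "b \<noteq> 0"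
  shows "parallel a c"
proof -
  obtain x where "a = x *s b" using parallelE assms by blast
  moreover obtain y where "c = y *s b"
    using parallelE assms parallel_commute by blast
  ultimately show ?thesis by (simp add: parallel_def algebra_simps)
qed

lemma same_point_iff_parallel: "same_point x y \<longleftrightarrow> x \<noteq> 0 \<and> y \<noteq> 0 \<and> parallel x y"
  unfolding same_point_def by (metis parallelE parallel_smult(1) vec.scale_zero_left)

definition minor :: "4 \<Rightarrow> 4 \<Rightarrow> 4 \<Rightarrow> 'a::comm_ring_1 ^ 4 \<Rightarrow> 'a ^ 4 \<Rightarrow> 'a ^ 4 \<Rightarrow> 'a" where
  "minor p q r a b c =
     a $ p * (b $ q * c $ r - b $ r * c $ q) - a $ q * (b $ p * c $ r - b $ r * c $ p)
     + a $ r * (b $ p * c $ q - b $ q * c $ p)"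

text \<open>The generalized cross product: the signs make \<open>dot d (wedge a b c)\<close> the 4x4
  determinant with rows \<open>d\<close>, \<open>a\<close>, \<open>b\<close>,
  \<open>c\<close>.\<close>

definition wedge :: "'a::comm_ring_1 ^ 4 \<Rightarrow> 'a ^ 4 \<Rightarrow> 'a ^ 4 \<Rightarrow> 'a ^ 4" where
  "wedge a b c = (\<chi> l. if l = 0 then minor 1 2 3 a b c else if l = 1 then - minor 0 2 3 a b c
      else if l = 2 then minor 0 1 3 a b c else - minor 0 1 2 a b c)"

lemma wedge_nth:
  "wedge a b c $ 0 = minor 1 2 3 a b c" "wedge a b c $ 1 = - minor 0 2 3 a b c"
  "wedge a b c $ 2 = minor 0 1 3 a b c" "wedge a b c $ 3 = - minor 0 1 2 a b c"
  by (simp_all add: wedge_def)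

lemma wedge_rotate: "wedge b c a = wedge a b c"
  by (simp add: vec_eq_iff wedge_def minor_def algebra_simps)

lemma wedge_swap: "wedge b a c = - wedge a b c"
  by (simp add: vec_eq_iff wedge_def minor_def algebra_simps)

lemma wedge_add1: "wedge (a + a') b c = wedge a b c + wedge a' b c"
  by (simp add: vec_eq_iff wedge_def minor_def algebra_simps)

lemma wedge_smult1: "wedge (r *s a) b c = r *s wedge a b c"
  by (simp add: vec_eq_iff wedge_def minor_def algebra_simps)

lemma wedge_linear [simp]:
  "wedge (a + a') b c = wedge a b c + wedge a' b c" "wedge (r *s a) b c = r *s wedge a b c"
  "wedge a (b + b') c = wedge a b c + wedge a b' c" "wedge a (r *s b) c = r *s wedge a b c"
  "wedge a b (c + c') = wedge a b c + wedge a b c'" "wedge a b (r *s c) = r *s wedge a b c"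
  by (metis wedge_add1 wedge_smult1 wedge_rotate)+

lemma dot_wedge_self [simp]:
  "dot a (wedge a b c) = 0" "dot b (wedge a b c) = 0" "dot c (wedge a b c) = 0"
  by (simp_all add: dot_def sum_4 wedge_nth minor_def algebra_simps)

text \<open>Both sides are 4x4 determinants, and two rows are exchanged.\<close>

lemma dot_wedge_swap: "dot a (wedge d b c) = - dot d (wedge a b c)"
  by (simp add: dot_def sum_4 wedge_nth minor_def algebra_simps)

text \<open>Each 2x2 minor of \<open>x\<close> and the wedge is, up to sign, some
  \<open>?e p q\<close>: a combination of the three pairings with 2x2 minors of the forms as
  coefficients. The identity also covers dependent forms.\<close>

lemma parallel_wedge:
  assumes "dot a x = 0" "dot b x = 0" "dot c x = 0"
  shows "parallel x (wedge a b c)"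
proof -
  let ?m = "\<lambda>p q b c. b $ p * c $ q - b $ q * c $ p"
  let ?e = "\<lambda>p q. dot a x * ?m p q b c - dot b x * ?m p q a c + dot c x * ?m p q a b"
  let ?W = "wedge a b c"
  have "x $ 1 * ?W $ 0 - x $ 0 * ?W $ 1 = ?e 2 3"
    "x $ 2 * ?W $ 0 - x $ 0 * ?W $ 2 = - ?e 1 3"
    "x $ 3 * ?W $ 0 - x $ 0 * ?W $ 3 = ?e 1 2"
    "x $ 2 * ?W $ 1 - x $ 1 * ?W $ 2 = ?e 0 3"
    "x $ 3 * ?W $ 1 - x $ 1 * ?W $ 3 = - ?e 0 2"
    "x $ 3 * ?W $ 2 - x $ 2 * ?W $ 3 = ?e 0 1"
    unfolding dot_def sum_4 wedge_nth minor_def by (simp_all add: algebra_simps)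
  then show ?thesis
    unfolding assms parallel_def forall_4 by simp
qed

text \<open>Cramer's rule: for a nonzero minor \<open>m\<close> of \<open>a\<close> and
  \<open>b\<close> in the columns \<open>p\<close>, \<open>q\<close>, the vanishing of
  \<open>minor p q l a b c\<close> expresses \<open>m * c $ l\<close> through \<open>a $ l\<close>
  and \<open>b $ l\<close>.\<close>

lemma wedge_eq_0_imp_span:
  fixes a b c :: "'a::field ^ 4"
  assumes "wedge a b c = 0" "\<not> parallel a b"
  obtains x y where "c = x *s a + y *s b"
proof -
  obtain p q where pq: "a $ p * b $ q - a $ q * b $ p \<noteq> 0"
    using assms(2) by (auto simp: parallel_def)
  define m where "m = a $ p * b $ q - a $ q * b $ p"
  have w: "minor 1 2 3 a b c = 0" "minor 0 2 3 a b c = 0" "minor 0 1 3 a b c = 0"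
      "minor 0 1 2 a b c = 0"
    using assms(1) by (auto simp: vec_eq_iff forall_4 wedge_nth)
  \<comment> \<open>The minor alternates in its column indices, so the four increasing triples
    determine all the others.\<close>
  have "\<forall>p q l. minor p q l a b c = 0"
    using w unfolding forall_4 minor_def by (auto simp: algebra_simps)
  then have "minor p q l a b c = 0" for l
    by blast
  then have "m * c $ l = (c $ p * b $ q - c $ q * b $ p) * a $ l
       + (a $ p * c $ q - a $ q * c $ p) * b $ l" for l
    unfolding m_def minor_def by (simp add: algebra_simps)
  moreover have "z = x / m * a' + y / m * b'" if "m * z = x * a' + y * b'" for x y z a' b'
    using that pq[folded m_def] by (simp add: field_simps)
  ultimately have "c $ l = (c $ p * b $ q - c $ q * b $ p) / m * a $ l
       + (a $ p * c $ q - a $ q * c $ p) / m * b $ l" for l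
    by blast
  then have "c = ((c $ p * b $ q - c $ q * b $ p) / m) *s a
       + ((a $ p * c $ q - a $ q * c $ p) / m) *s b"
    unfolding vec_eq_iff vector_add_component vector_smult_component by blast
  then show ?thesis
    by (rule that)
qed

text \<open>If \<open>wedge x y z\<close> were nonzero, \<open>a\<close> and \<open>b\<close> would
  both be multiples of it and hence parallel.\<close>

lemma orthogonal_pair_span:
  fixes a b x y z :: "'a::field ^ 4"
  assumes "\<not> parallel a b" "\<not> parallel x y"
    and "dot a x = 0" "dot a y = 0" "dot a z = 0" "dot b x = 0" "dot b y = 0" "dot b z = 0"
  obtains c d where "z = c *s x + d *s y"
proof -
  have dc: "dot u v = dot v u" for u v :: "'a ^ 4"
    by (simp add: dot_def mult.commute)
  have "parallel a (wedge x y z)" "parallel b (wedge x y z)"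
    using assms by (auto intro!: parallel_wedge simp: dc[of _ a] dc[of _ b])
  then have "wedge x y z = 0"
    using parallel_trans parallel_commute assms(1) by blast
  then show ?thesis using wedge_eq_0_imp_span assms(2) that by blast
qed

section \<open>Trilinear maps with arbitrary complex data\<close>

lemma axis_one_nth: "axis i 1 $ j = (if j = i then 1 else 0)"
  by (simp add: axis_def)

definition trilinear ::
    "(2 \<Rightarrow> 2 \<Rightarrow> 2 \<Rightarrow> complex) \<Rightarrow> (2 \<Rightarrow> 2 \<Rightarrow> 2 \<Rightarrow> complex ^ 4) \<Rightarrow> trimap" where
  "trilinear v Q s t u =
     (\<Sum>i\<in>UNIV. \<Sum>j\<in>UNIV. \<Sum>k\<in>UNIV. (v i j k * s $ i * t $ j * u $ k) *s Q i j k)"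

lemma trilinear_slice: "trilinear v Q s (axis j 1) (axis k 1)
    = (s $ 0 * v 0 j k) *s Q 0 j k + (s $ 1 * v 1 j k) *s Q 1 j k"
proof -
  have sum_if: "(\<Sum>l\<in>UNIV. if l = m then g l else 0) = g m" for g :: "2 \<Rightarrow> complex ^ 4" and m
    by simp
  have "(v i j' k' * s $ i * axis j 1 $ j' * axis k 1 $ k') *s Q i j' k'
      = (if k' = k then if j' = j then (s $ i * v i j k) *s Q i j k else 0 else 0)" for i j' k'
    by (auto simp: axis_def)
  then have "trilinear v Q s (axis j 1) (axis k 1) = (\<Sum>i\<in>UNIV. (s $ i * v i j k) *s Q i j k)"
    unfolding trilinear_def by (simp only: sum_if)
  then show ?thesis by (simp add: sum_two)
qed

text \<open>The cyclic symmetry of the three factors; it transfers statements about \<open>s\<close>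
  to \<open>t\<close> and \<open>u\<close>.\<close>

lemma trilinear_rotate:
  "trilinear (\<lambda>j k i. v i j k) (\<lambda>j k i. Q i j k) t u s = trilinear v Q s t u"
proof -
  let ?g = "\<lambda>i j k. (v i j k * s $ i * t $ j * u $ k) *s Q i j k"
  have "trilinear (\<lambda>j k i. v i j k) (\<lambda>j k i. Q i j k) t u s
      = (\<Sum>j\<in>UNIV. \<Sum>k\<in>UNIV. \<Sum>i\<in>UNIV. ?g i j k)"
    by (simp add: trilinear_def ac_simps)
  also have "\<dots> = (\<Sum>j\<in>UNIV. \<Sum>i\<in>UNIV. \<Sum>k\<in>UNIV. ?g i j k)"
    by (intro sum.cong refl sum.swap)
  also have "\<dots> = trilinear v Q s t u"
    unfolding trilinear_def by (rule sum.swap)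
  finally show ?thesis .
qed

section \<open>Linear forms\<close>

definition linear_form :: "complex ^ 4 \<Rightarrow> 4 cpoly" where
  "linear_form a = (\<Sum>i\<in>UNIV. Poly_Mapping.single (Poly_Mapping.single i 1) (a $ i))"

lemma lookup_linear_form:
  "Poly_Mapping.lookup (linear_form a) m = (\<Sum>i\<in>UNIV. if m = Poly_Mapping.single i 1 then a $ i else 0)"
  by (simp add: linear_form_def lookup_sum lookup_single when_def eq_commute[of m])

lemma single_one_eq_iff: "Poly_Mapping.single i (Suc 0) = Poly_Mapping.single j (Suc 0) \<longleftrightarrow> i = j"
  by (metis lookup_single_eq lookup_single_not_eq nat.distinct(1))

lemma lookup_linear_form_single: "Poly_Mapping.lookup (linear_form a) (Poly_Mapping.single i (Suc 0)) = a $ i"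
  by (simp add: lookup_linear_form single_one_eq_iff)

lemma keys_linear_form: "Poly_Mapping.keys (linear_form a) \<subseteq> (\<lambda>i. Poly_Mapping.single i 1) ` UNIV"
proof
  fix m assume "m \<in> Poly_Mapping.keys (linear_form a)"
  then show "m \<in> (\<lambda>i. Poly_Mapping.single i 1) ` UNIV"
    by (auto simp: in_keys_iff lookup_linear_form split: if_splits elim: sum.not_neutral_contains_not_neutral)
qed

lemma peval_superset:
  assumes "finite M" "Poly_Mapping.keys G \<subseteq> M"
  shows "peval G x = (\<Sum>m\<in>M. Poly_Mapping.lookup G m * (\<Prod>i\<in>UNIV. (x $ i) ^ Poly_Mapping.lookup m i))"
  unfolding peval_def using assms
  by (intro sum.mono_neutral_left) (auto simp: in_keys_iff)

lemma prod_power_single: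
  fixes x :: "'n::finite \<Rightarrow> complex"
  shows "(\<Prod>j\<in>UNIV. x j ^ Poly_Mapping.lookup (Poly_Mapping.single i (Suc 0)) j) = x i"
proof -
  have "(\<Prod>j\<in>UNIV. x j ^ Poly_Mapping.lookup (Poly_Mapping.single i (Suc 0)) j)
      = (\<Prod>j\<in>UNIV. if j = i then x j else 1)"
    by (intro prod.cong) (auto simp: lookup_single when_def)
  then show ?thesis by simp
qed

lemma peval_linear:
  fixes G :: "4 cpoly"
  assumes "Poly_Mapping.keys G \<subseteq> (\<lambda>i. Poly_Mapping.single i 1) ` UNIV"
  shows "peval G x = (\<Sum>i\<in>UNIV. Poly_Mapping.lookup G (Poly_Mapping.single i 1) * x $ i)"
proof -
  have "inj (\<lambda>i::4. Poly_Mapping.single i (1::nat))"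
    by (simp add: inj_def single_one_eq_iff)
  then show ?thesis
    by (subst peval_superset[OF _ assms]) (simp_all add: sum.reindex prod_power_single)
qed

lemma peval_linear_form: "peval (linear_form a) x = dot a x"
  unfolding dot_def by (subst peval_linear[OF keys_linear_form]) (simp add: lookup_linear_form_single)

lemma homogeneous_linear_form: "homogeneous 1 (linear_form a)"
proof -
  have "(\<Sum>i\<in>UNIV. Poly_Mapping.lookup (Poly_Mapping.single j (1::nat)) i) = 1" for j :: 4
    by (simp add: lookup_single when_def)
  then show ?thesis
    unfolding homogeneous_def using keys_linear_form by fastforce
qed

lemma homogeneous_1_peval:
  fixes G :: "4 cpoly"
  assumes "homogeneous 1 G"
  obtains a where "\<And>x. peval G x = dot a x"
proof -
  have "Poly_Mapping.keys G \<subseteq> (\<lambda>i. Poly_Mapping.single i 1) ` UNIV"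
  proof
    fix m assume "m \<in> Poly_Mapping.keys G"
    then have s: "(\<Sum>i\<in>UNIV. Poly_Mapping.lookup m i) = 1"
      using assms by (simp add: homogeneous_def)
    then obtain i where i: "Poly_Mapping.lookup m i = 1" "\<And>j. j \<noteq> i \<Longrightarrow> Poly_Mapping.lookup m j = 0"
      using sum_eq_1_iff[of UNIV "Poly_Mapping.lookup m"] by (metis UNIV_I finite)
    then have "m = Poly_Mapping.single i 1"
      by (intro poly_mapping_eqI) (auto simp: lookup_single when_def)
    then show "m \<in> (\<lambda>i. Poly_Mapping.single i 1) ` UNIV" by blast
  qed
  from peval_linear[OF this] show ?thesis
    by (intro that[of "\<chi> i. Poly_Mapping.lookup G (Poly_Mapping.single i 1)"]) (simp add: dot_def)
qed

section \<open>Total degree and common divisors of linear forms\<close>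

definition total_degree :: "('n::finite \<Rightarrow>\<^sub>0 nat) \<Rightarrow> nat" where
  "total_degree m = (\<Sum>i\<in>UNIV. Poly_Mapping.lookup m i)"

lemma total_degree_add: "total_degree (m + m') = total_degree m + total_degree m'"
  by (simp add: total_degree_def lookup_add sum.distrib)

lemma total_degree_eq_0_iff: "total_degree m = 0 \<longleftrightarrow> m = 0"
  by (auto simp: total_degree_def intro: poly_mapping_eqI)

text \<open>
  Substitutes \<open>h x\<^sub>i\<close> for every variable \<open>x\<^sub>i\<close>, with a new variable \<open>h\<close>. As the target is a univariate
  polynomial ring over a domain, total degrees become additive under multiplication.
\<close>

definition grade :: "'n::finite cpoly \<Rightarrow> 'n cpoly poly" where
  "grade G = (\<Sum>m\<in>Poly_Mapping.keys G. monom (Poly_Mapping.single m (Poly_Mapping.lookup G m)) (total_degree m))"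

lemma grade_superset:
  assumes "finite M" "Poly_Mapping.keys G \<subseteq> M"
  shows "grade G = (\<Sum>m\<in>M. monom (Poly_Mapping.single m (Poly_Mapping.lookup G m)) (total_degree m))"
  unfolding grade_def using assms
  by (intro sum.mono_neutral_left) (auto simp: in_keys_iff)

lemma grade_add: "grade (G + H) = grade G + grade H"
proof -
  let ?M = "Poly_Mapping.keys G \<union> Poly_Mapping.keys H"
  have "Poly_Mapping.keys (G + H) \<subseteq> ?M" by (rule Poly_Mapping.keys_add)
  then have "grade (G + H) = (\<Sum>m\<in>?M. monom (Poly_Mapping.single m (Poly_Mapping.lookup G m)) (total_degree m)
      + monom (Poly_Mapping.single m (Poly_Mapping.lookup H m)) (total_degree m))"
    by (subst grade_superset[where M = ?M])
      (simp_all only: finite_Un finite_keys lookup_add single_add add_monom)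
  also have "\<dots> = grade G + grade H"
    unfolding sum.distrib by (intro arg_cong2[where f = "(+)"] grade_superset[symmetric]) auto
  finally show ?thesis .
qed

lemma grade_0 [simp]: "grade 0 = 0"
  by (simp add: grade_def)

lemma grade_sum: "grade (sum g A) = (\<Sum>x\<in>A. grade (g x))"
  by (induction A rule: infinite_finite_induct) (simp_all add: grade_add)

lemma grade_single: "grade (Poly_Mapping.single m c) = monom (Poly_Mapping.single m c) (total_degree m)"
  by (cases "c = 0") (simp_all add: grade_def)

lemma poly_mapping_sum_single:
  "G = (\<Sum>m\<in>Poly_Mapping.keys G. Poly_Mapping.single m (Poly_Mapping.lookup G m))"
  by (rule poly_mapping_eqI) (auto simp: lookup_sum lookup_single when_def in_keys_iff)

lemma grade_mult: "grade (G * H) = grade G * grade H"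
proof -
  let ?s = "\<lambda>G m. Poly_Mapping.single m (Poly_Mapping.lookup G m)"
  have "G * H = (\<Sum>m\<in>Poly_Mapping.keys G. \<Sum>m'\<in>Poly_Mapping.keys H. ?s G m * ?s H m')"
    by (subst poly_mapping_sum_single[of G], subst poly_mapping_sum_single[of H]) (simp only: sum_product)
  then show ?thesis
    by (simp add: grade_sum mult_single grade_single total_degree_add grade_def[of G] grade_def[of H]
        sum_product mult_monom)
qed

text \<open>\<open>grade\<close> keeps every monomial in the coefficients, so distinct monomials of
  equal degree cannot cancel, and a nonconstant one would force positive degree.\<close>

lemma degree_grade_eq_0D:
  assumes "degree (grade G) = 0"
  shows "G = Poly_Mapping.single 0 (Poly_Mapping.lookup G 0)"
proof -
  have "m = 0" if m: "m \<in> Poly_Mapping.keys G" for m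
  proof (rule ccontr)
    assume "m \<noteq> 0"
    then have "coeff (grade G) (total_degree m) = 0"
      using assms total_degree_eq_0_iff[of m] by (intro coeff_eq_0) auto
    then have "Poly_Mapping.lookup (coeff (grade G) (total_degree m)) m = 0"
      by simp
    moreover have "Poly_Mapping.lookup (coeff (grade G) (total_degree m)) m
        = (\<Sum>m'\<in>Poly_Mapping.keys G. if m' = m then Poly_Mapping.lookup G m else 0)"
      unfolding grade_def coeff_sum coeff_monom lookup_sum
      by (intro sum.cong) (auto simp: lookup_single when_def)
    ultimately show False using m by (auto simp: in_keys_iff)
  qed
  then show ?thesis
    by (intro poly_mapping_eqI) (auto simp: lookup_single when_def in_keys_iff)
qed

lemma lookup_mult_single_0:
  "Poly_Mapping.lookup (G * Poly_Mapping.single 0 c) m = Poly_Mapping.lookup G m * (c :: complex)"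
  for G :: "'n cpoly"
  by (simp add: mult.commute[of G] map.rep_eq when_def flip: mult_map_scale_conv_mult)

text \<open>By additivity of degrees a common divisor \<open>D\<close> has degree 0 or 1. In degree
  0 it is a nonzero constant, hence a unit; in degree 1 both cofactors are constants, so both forms
  are multiples of \<open>D\<close> and thus parallel.\<close>

lemma no_common_factor_linear_form:
  assumes "\<not> parallel a b"
  shows "no_common_factor (linear_form a) (linear_form b)"
  unfolding no_common_factor_def
proof (intro allI impI)
  fix D assume "D dvd linear_form a" "D dvd linear_form b"
  then obtain G H where G: "linear_form a = D * G" and H: "linear_form b = D * H"
    by (auto elim!: dvdE)
  have ne: "linear_form c \<noteq> 0" if "c \<noteq> 0" for c
    using that lookup_linear_form_single[of c] by (auto simp: vec_eq_iff)
  have deg: "degree (grade (linear_form c)) = 1 \<and> grade (linear_form c) \<noteq> 0" if "c \<noteq> 0" for c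
  proof -
    have "total_degree (Poly_Mapping.single i (Suc 0)) = 1" for i :: 4
      by (simp add: total_degree_def lookup_single when_def)
    then have "grade (linear_form c) = monom (linear_form c) 1"
      by (simp add: linear_form_def grade_add grade_single sum_4 add_monom)
    then show ?thesis using ne[OF that] by (simp add: degree_monom_eq)
  qed
  have "a \<noteq> 0" "b \<noteq> 0" using assms by auto
  then have DG: "degree (grade D) + degree (grade G) = 1" and DH: "degree (grade D) + degree (grade H) = 1"
    and D0: "grade D \<noteq> 0"
    using deg[of a] deg[of b] unfolding G H grade_mult by (auto simp: degree_mult_eq)
  show "D dvd 1"
  proof (cases "degree (grade D) = 0")
    case True
    then obtain c where D: "D = Poly_Mapping.single 0 c" using degree_grade_eq_0D by blast
    with D0 have "c \<noteq> 0" by auto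
    then have "1 = D * Poly_Mapping.single 0 (inverse c)" by (simp add: D mult_single)
    then show ?thesis by (rule dvdI)
  next
    case False
    then have "degree (grade G) = 0" "degree (grade H) = 0" using DG DH by auto
    then obtain g h where "G = Poly_Mapping.single 0 g" "H = Poly_Mapping.single 0 h"
      using degree_grade_eq_0D by blast
    then have "a $ i = Poly_Mapping.lookup D (Poly_Mapping.single i 1) * g"
      "b $ i = Poly_Mapping.lookup D (Poly_Mapping.single i 1) * h" for i
      using G H by (metis One_nat_def lookup_linear_form_single lookup_mult_single_0)+
    then have "parallel a b" by (simp add: parallel_def)
    with assms show ?thesis by blast
  qed
qed

section \<open>Polynomial functions of one variable\<close>

definition polyfun :: "(complex \<Rightarrow> complex) \<Rightarrow> bool" where
  "polyfun g \<longleftrightarrow> (\<exists>p. g = poly p)"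

lemma polyfun_const: "polyfun (\<lambda>h. c)"
  unfolding polyfun_def by (intro exI[of _ "[:c:]"]) auto

lemma polyfun_id: "polyfun (\<lambda>h. h)"
  unfolding polyfun_def by (intro exI[of _ "[:0, 1:]"]) auto

lemma polyfun_add: "polyfun f \<Longrightarrow> polyfun g \<Longrightarrow> polyfun (\<lambda>h. f h + g h)"
  unfolding polyfun_def by (auto simp: fun_eq_iff simp flip: poly_add)

lemma polyfun_diff: "polyfun f \<Longrightarrow> polyfun g \<Longrightarrow> polyfun (\<lambda>h. f h - g h)"
  unfolding polyfun_def by (auto simp: fun_eq_iff simp flip: poly_diff)

lemma polyfun_mult: "polyfun f \<Longrightarrow> polyfun g \<Longrightarrow> polyfun (\<lambda>h. f h * g h)"
  unfolding polyfun_def by (auto simp: fun_eq_iff simp flip: poly_mult)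

lemma polyfun_sum: "(\<And>i. i \<in> I \<Longrightarrow> polyfun (f i)) \<Longrightarrow> polyfun (\<lambda>h. \<Sum>i\<in>I. f i h)"
  by (induction I rule: infinite_finite_induct) (auto intro: polyfun_const polyfun_add)

lemmas polyfun_intros =
  polyfun_const polyfun_id polyfun_add polyfun_diff polyfun_mult polyfun_sum

text \<open>A polynomial over an infinite field that vanishes everywhere is zero, the polynomial
  ring is a domain, and \<open>g\<close> is not the zero polynomial.\<close>

lemma polyfun_mult_eq_0:
  assumes "polyfun f" "polyfun g" "\<And>h. f h * g h = 0" "g h0 \<noteq> 0"
  shows "f h = 0"
proof -
  obtain p q where p: "f = poly p" and q: "g = poly q" using assms(1,2) by (auto simp: polyfun_def)
  have "poly (p * q) = poly 0" using assms(3) p q by auto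
  then have "p * q = 0" using poly_eq_poly_eq_iff by blast
  then show ?thesis using assms(4) p q by auto
qed

section \<open>Pencils of planes\<close>

definition blend :: "complex ^ 2 \<Rightarrow> (2 \<Rightarrow> complex ^ 4) \<Rightarrow> complex ^ 2 \<Rightarrow> complex ^ 4" where
  "blend \<alpha> S s = (\<Sum>i\<in>UNIV. (\<alpha> $ i * s $ i) *s S i)"

definition pencil :: "complex ^ 2 \<Rightarrow> (2 \<Rightarrow> complex ^ 4) \<Rightarrow> 2 \<Rightarrow> 4 cpoly" where
  "pencil \<alpha> S i = linear_form (if i = 0 then \<alpha> $ 1 *s S 1 else - \<alpha> $ 0 *s S 0)"

lemma eval_pencil:
  "eval_pair (pencil \<alpha> S) x $ 0 = \<alpha> $ 1 * dot (S 1) x"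
  "eval_pair (pencil \<alpha> S) x $ 1 = - \<alpha> $ 0 * dot (S 0) x"
  by (simp_all add: eval_pair_def pencil_def peval_linear_form)

lemma blend_smult: "blend \<alpha> S (c *s s) = c *s blend \<alpha> S s"
  by (simp add: blend_def sum_two vec.scale_right_distrib ac_simps)

text \<open>The pairing is the 2x2 determinant of the \<open>pencil\<close> values at
  \<open>x\<close> and \<open>s\<close>. So the member of the pencil with parameter \<open>s\<close>
  passes through \<open>x\<close> exactly when the \<open>pencil\<close> values are proportional to
  \<open>s\<close>.\<close>

lemma dot_blend_eq_0_iff:
  "dot (blend \<alpha> S s) x = 0 \<longleftrightarrow> parallel (eval_pair (pencil \<alpha> S) x) s"
proof -
  have "dot (blend \<alpha> S s) x
      = eval_pair (pencil \<alpha> S) x $ 0 * s $ 1 - eval_pair (pencil \<alpha> S) x $ 1 * s $ 0"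
    by (simp add: blend_def sum_two eval_pencil)
  then show ?thesis
    by (auto simp: parallel_def forall_two)
qed

text \<open>The point \<open>x\<close> lies on one plane but not on the other, which rules out
  proportional forms.\<close>

lemma no_common_factor_pencil:
  assumes "\<alpha> $ 0 \<noteq> 0" "\<alpha> $ 1 \<noteq> 0" "S 0 \<noteq> 0" "dot (S 0) x = 0" "dot (S 1) x \<noteq> 0"
  shows "no_common_factor (pencil \<alpha> S 0) (pencil \<alpha> S 1)"
proof -
  have "\<not> parallel (\<alpha> $ 1 *s S 1) (- \<alpha> $ 0 *s S 0)"
  proof
    assume "parallel (\<alpha> $ 1 *s S 1) (- \<alpha> $ 0 *s S 0)"
    then obtain c where "\<alpha> $ 1 *s S 1 = c *s (- \<alpha> $ 0 *s S 0)"
      by (rule parallelE) (use assms(1,3) in simp)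
    then have "dot (\<alpha> $ 1 *s S 1) x = dot (c *s (- \<alpha> $ 0 *s S 0)) x" by simp
    then show False using assms by simp
  qed
  from no_common_factor_linear_form[OF this] show ?thesis
    by (simp add: pencil_def)
qed

section \<open>Trilinear maps of a hexahedron\<close>

text \<open>What remains of the geometry once closures and lines are turned into linear algebra. The
  list is invariant under cyclic permutation of the three directions, so by \<open>rotated\<close>
  each fact needs a proof in one direction only.\<close>

locale hexahedron =
  fixes S T U :: "2 \<Rightarrow> complex ^ 4"
    and Q :: "2 \<Rightarrow> 2 \<Rightarrow> 2 \<Rightarrow> complex ^ 4"
    and v :: "2 \<Rightarrow> 2 \<Rightarrow> 2 \<Rightarrow> complex"
  assumes dot_Q: "dot (S i) (Q i j k) = 0" "dot (T j) (Q i j k) = 0" "dot (U k) (Q i j k) = 0"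
    and Q_0: "Q i j k $ 0 = 1"
    and wedge_neq_0: "wedge (S i) (T j) (U k) \<noteq> 0"
    and Q_distinct: "Q 0 j k \<noteq> Q 1 j k" "Q i 0 k \<noteq> Q i 1 k" "Q i j 0 \<noteq> Q i j 1"
    and v_neq_0: "v i j k \<noteq> 0"
begin

abbreviation F :: trimap where
  "F \<equiv> trilinear v Q"

definition \<Delta> :: "2 \<Rightarrow> 2 \<Rightarrow> 2 \<Rightarrow> complex" where
  "\<Delta> i j k = wedge (S i) (T j) (U k) $ 0"

lemma Q_neq_0: "Q i j k \<noteq> 0"
  using Q_0[of i j k] by auto

lemma S_neq_0: "S i \<noteq> 0"
proof
  assume "S i = 0"
  then have "wedge (S i) (T 0) (U 0) = 0"
    by (simp add: vec_eq_iff wedge_def minor_def)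
  then show False using wedge_neq_0 by blast
qed

text \<open>The vertex satisfies the three plane equations, so the wedge is a multiple of it; the
  normalization \<open>Q_0\<close> identifies the factor as the coordinate 0 of the wedge.\<close>

lemma wedge_eq: "wedge (S i) (T j) (U k) = \<Delta> i j k *s Q i j k"
proof -
  have "parallel (wedge (S i) (T j) (U k)) (Q i j k)"
    using dot_Q parallel_wedge parallel_commute by blast
  then obtain c where c: "wedge (S i) (T j) (U k) = c *s Q i j k"
    using parallelE Q_neq_0 by blast
  then show ?thesis by (simp add: \<Delta>_def Q_0)
qed

lemma \<Delta>_neq_0: "\<Delta> i j k \<noteq> 0"
  using wedge_neq_0[of i j k] unfolding wedge_eq by auto

lemma dot_eq_0_imp_eq_Q:
  assumes "dot (S i) x = 0" "dot (T j) x = 0" "dot (U k) x = 0" "x $ 0 = 1"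
  shows "x = Q i j k"
proof -
  have "parallel x (Q i j k)"
    using parallel_trans[OF parallel_wedge[OF assms(1-3)]] wedge_eq[of i j k] wedge_neq_0[of i j k]
    by auto
  then obtain c where "x = c *s Q i j k" using parallelE Q_neq_0 by blast
  then show ?thesis using assms(4) Q_0[of i j k] by auto
qed

text \<open>A vertex on the opposite plane as well would coincide with its neighbour
  \<open>Q i' j k\<close>.\<close>

lemma dot_S_neq_0: "i \<noteq> i' \<Longrightarrow> dot (S i') (Q i j k) \<noteq> 0"
  using two_neq_cases[of i i'] dot_eq_0_imp_eq_Q[of i' "Q i j k" j k] Q_distinct(1)[of j k]
    dot_Q(2-3) Q_0 by force

lemma rotated: "hexahedron T U S (\<lambda>j k i. Q i j k) (\<lambda>j k i. v i j k)"
  using dot_Q Q_0 Q_distinct v_neq_0 wedge_neq_0 by unfold_locales (auto simp: wedge_rotate)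

lemmas dot_T_neq_0 = hexahedron.dot_S_neq_0[OF rotated]
  and dot_U_neq_0 = hexahedron.dot_S_neq_0[OF hexahedron.rotated[OF rotated]]
  and T_neq_0 = hexahedron.S_neq_0[OF rotated]
  and U_neq_0 = hexahedron.S_neq_0[OF hexahedron.rotated[OF rotated]]

text \<open>The three vertices are independent: the first two are distinct normalized points on the
  plane \<open>T 0\<close>, the third is off it. Their wedge is therefore nonzero, and both
  \<open>a\<close> and \<open>S i\<close> are multiples of it.\<close>

lemma parallel_S:
  assumes "i \<noteq> i'" "dot a (Q i 0 0) = 0" "dot a (Q i 0 1) = 0" "dot a (Q i 1 0) = 0"
  shows "parallel a (S i)"
proof -
  have dc: "dot x y = dot y x" for x y :: "complex ^ 4"
    by (simp add: dot_def mult.commute)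
  let ?W = "wedge (Q i 0 0) (Q i 0 1) (Q i 1 0)"
  have "\<not> parallel (Q i 0 0) (Q i 0 1)"
  proof
    assume "parallel (Q i 0 0) (Q i 0 1)"
    then obtain c where "Q i 0 0 = c *s Q i 0 1" using parallelE Q_neq_0 by blast
    then have "Q i 0 0 = Q i 0 1" using Q_0[of i 0 0] Q_0[of i 0 1] by simp
    then show False using Q_distinct(3) by blast
  qed
  moreover have "Q i 1 0 \<noteq> x *s Q i 0 0 + y *s Q i 0 1" for x y
    using dot_T_neq_0[of 1 0 i 0] dot_Q(2)[where j = 0] by auto
  ultimately have "?W \<noteq> 0"
    using wedge_eq_0_imp_span by blast
  moreover have "parallel a ?W" "parallel (S i) ?W"
    using assms dot_Q(1) by (auto intro!: parallel_wedge simp: dc[of _ a] dc[of _ "S i"])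
  ultimately show ?thesis
    using parallel_trans parallel_commute by blast
qed

section \<open>From a linear inverse to rank one\<close>

lemma slices_proportional:
  assumes "\<And>s t u. s $ 1 * dot a0 (F s t u) = s $ 0 * dot a1 (F s t u)"
    and "a0 \<noteq> 0 \<or> a1 \<noteq> 0"
  shows "\<exists>\<rho>. \<forall>j k. v 1 j k / \<Delta> 1 j k = \<rho> * (v 0 j k / \<Delta> 0 j k)"
proof -
  let ?e = "\<lambda>i. axis i (1 :: complex) :: complex ^ 2"
  let ?W = "\<lambda>i j k. v i j k / \<Delta> i j k"
  have "dot a1 (Q 0 j k) = 0" for j k
    using assms(1)[of "?e 0" "?e j" "?e k"] v_neq_0 by (simp add: trilinear_slice axis_one_nth)
  then obtain c1 where c1: "a1 = c1 *s S 0"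
    using parallel_S[of 0 1 a1] parallelE[of a1 "S 0"] S_neq_0 by (metis zero_neq_one)
  have "dot a0 (Q 1 j k) = 0" for j k
    using assms(1)[of "?e 1" "?e j" "?e k"] v_neq_0 by (simp add: trilinear_slice axis_one_nth)
  then obtain c0 where c0: "a0 = c0 *s S 1"
    using parallel_S[of 1 0 a0] parallelE[of a0 "S 1"] S_neq_0 by (metis zero_neq_one)
  have W: "c0 * ?W 0 j k = - c1 * ?W 1 j k" for j k
  proof -
    let ?M = "dot (S 1) (wedge (S 0) (T j) (U k))"
    have v: "v i j k *s Q i j k = ?W i j k *s wedge (S i) (T j) (U k)" for i
      using \<Delta>_neq_0 by (simp add: wedge_eq)
    \<comment> \<open>At \<open>s = (1, 1)\<close> the squared terms drop out, as each form vanishes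
      on its own face; only the mixed term is left. The two wedge pairings in it differ by the sign
      from \<open>dot_wedge_swap\<close>.\<close>
    have "dot a0 (v 0 j k *s Q 0 j k) = dot a1 (v 1 j k *s Q 1 j k)"
      using assms(1)[of "?e 0 + ?e 1" "?e j" "?e k"] by (simp add: trilinear_slice axis_one_nth c0 c1 dot_Q)
    then have "c0 * (?W 0 j k * ?M) = c1 * (?W 1 j k * dot (S 0) (wedge (S 1) (T j) (U k)))"
      unfolding v c0 c1 by (simp add: mult.left_commute)
    moreover have "dot (S 0) (wedge (S 1) (T j) (U k)) = - ?M"
      by (rule dot_wedge_swap)
    moreover have "?M \<noteq> 0"
      using dot_S_neq_0[of 0 1 j k] \<Delta>_neq_0 by (simp add: wedge_eq)
    ultimately have "(c0 * ?W 0 j k + c1 * ?W 1 j k) * ?M = 0" "?M \<noteq> 0"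
      by (simp_all add: distrib_right mult.assoc)
    then show ?thesis by (simp add: eq_neg_iff_add_eq_0)
  qed
  \<comment> \<open>Otherwise \<open>W\<close> would also give \<open>c0 = 0\<close>, and both forms
    would vanish.\<close>
  have "c1 \<noteq> 0"
    using W[of 0 0] v_neq_0 \<Delta>_neq_0 assms(2) c0 c1 by auto
  then have "x = (- c0 / c1) * y" if "c0 * y = - c1 * x" for x y
    using that by (simp add: field_simps)
  with W have "?W 1 j k = (- c0 / c1) * ?W 0 j k" for j k
    by blast
  then show ?thesis by blast
qed

lemma rotated_\<Delta>: "hexahedron.\<Delta> T U S j k i = \<Delta> i j k"
  by (simp add: hexahedron.\<Delta>_def[OF rotated] \<Delta>_def wedge_rotate)

text \<open>The argument restricts the identity to the line through a generic point and the given one.\<close>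

lemma identity_extends:
  assumes "\<And>s t u j k. dot (b j) (F s t u) \<noteq> 0 \<Longrightarrow> dot (c k) (F s t u) \<noteq> 0 \<Longrightarrow>
      s $ 1 * dot a0 (F s t u) = s $ 0 * dot a1 (F s t u)"
    and "dot (b j) (F s' t' u') \<noteq> 0" "dot (c k) (F s' t' u') \<noteq> 0"
  shows "s $ 1 * dot a0 (F s t u) = s $ 0 * dot a1 (F s t u)"
proof -
  define l :: "complex ^ 2 \<Rightarrow> complex ^ 2 \<Rightarrow> complex \<Rightarrow> complex ^ 2"
    where "l = (\<lambda>y y' h. \<chi> i. y $ i + h * (y' $ i - y $ i))"
  have l: "l y y' 0 = y" "l y y' 1 = y'" for y y'
    by (simp_all add: l_def vec_eq_iff)
  define G where "G h = F (l s s' h) (l t t' h) (l u u' h)" for h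
  define e where "e h = l s s' h $ 1 * dot a0 (G h) - l s s' h $ 0 * dot a1 (G h)" for h
  have G: "polyfun (\<lambda>h. dot d (G h))" for d
    unfolding G_def trilinear_def dot_def l_def by (simp, intro polyfun_intros)
  have l_nth: "polyfun (\<lambda>h. l y y' h $ i)" for y y' i
    unfolding l_def by (simp, intro polyfun_intros)
  have e: "polyfun e"
    unfolding e_def by (intro polyfun_diff polyfun_mult G l_nth)
  \<comment> \<open>On the line, \<open>h = 0\<close> is the given point and \<open>h = 1\<close>
    the generic one. Where both pairings are nonzero the hypothesis gives \<open>e h = 0\<close>.
    Being nonzero at \<open>h = 1\<close>, they can then be cancelled one at a time.\<close>
  have "e h * dot (b j) (G h) * dot (c k) (G h) = 0" for h
    using assms(1)[of j "l s s' h" "l t t' h" "l u u' h" k] by (auto simp: e_def G_def)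
  then have "e h * dot (b j) (G h) = 0" for h
    by (rule polyfun_mult_eq_0[OF polyfun_mult[OF e G] G, where ?h0.0 = 1])
      (use assms(3) in \<open>simp add: G_def l\<close>)
  then have "e 0 = 0"
    by (rule polyfun_mult_eq_0[OF e G, where ?h0.0 = 1]) (use assms(2) in \<open>simp add: G_def l\<close>)
  then show ?thesis
    by (simp add: e_def G_def l)
qed

lemma slices_proportional_if_generic:
  fixes a :: "2 \<Rightarrow> complex ^ 4"
  assumes "\<And>s t u j k. dot (b j) (F s t u) \<noteq> 0 \<Longrightarrow> dot (c k) (F s t u) \<noteq> 0 \<Longrightarrow>
      s $ 1 * dot (a 0) (F s t u) = s $ 0 * dot (a 1) (F s t u)"
    and "dot (a i) (F s' t' u') \<noteq> 0" "dot (b j) (F s' t' u') \<noteq> 0" "dot (c k) (F s' t' u') \<noteq> 0"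
  shows "\<exists>\<rho>. \<forall>j k. v 1 j k / \<Delta> 1 j k = \<rho> * (v 0 j k / \<Delta> 0 j k)"
proof -
  have "a i \<noteq> 0" using assms(2) by auto
  then have "a 0 \<noteq> 0 \<or> a 1 \<noteq> 0" using forall_two[of "\<lambda>i. a i = 0"] by blast
  moreover have "s $ 1 * dot (a 0) (F s t u) = s $ 0 * dot (a 1) (F s t u)" for s t u
    by (rule identity_extends[of b c]) (use assms in auto)
  ultimately show ?thesis
    using slices_proportional[of "a 0" "a 1"] by blast
qed

text \<open>The conclusion is rank one in polynomial form, in terms of the entries with at most one
  nonzero index. With no vectors to choose, it descends from complex to real numbers.\<close>

lemma birational_imp_rank_one:
  assumes "birational_of_type F (1, 1, 1)"
  shows "v i j k / \<Delta> i j k * (v 0 0 0 / \<Delta> 0 0 0)\<^sup>2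
    = v i 0 0 / \<Delta> i 0 0 * (v 0 j 0 / \<Delta> 0 j 0) * (v 0 0 k / \<Delta> 0 0 k)"
proof -
  obtain A B C where hom: "\<forall>i. homogeneous 1 (A i)" "\<forall>i. homogeneous 1 (B i)" "\<forall>i. homogeneous 1 (C i)"
    and inv: "inverse_rational_maps F A B C"
    using assms by (auto simp: birational_of_type_def)
  have linear: "\<exists>a. \<forall>i x. peval (G i) x = dot (a i) x"
    if "\<forall>i. homogeneous 1 (G i)" for G :: "2 \<Rightarrow> 4 cpoly"
  proof -
    have "\<exists>a. \<forall>x. peval (G i) x = dot a x" for i
      using homogeneous_1_peval[of "G i"] that by blast
    then show ?thesis by (intro choice) blast
  qed
  obtain a where a: "\<And>i x. peval (A i) x = dot (a i) x"
    using linear[OF hom(1)] by blast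
  obtain b where b: "\<And>i x. peval (B i) x = dot (b i) x"
    using linear[OF hom(2)] by blast
  obtain c where c: "\<And>i x. peval (C i) x = dot (c i) x"
    using linear[OF hom(3)] by blast
  have neq_0: "eval_pair A x \<noteq> 0 \<longleftrightarrow> (\<exists>i. dot (a i) x \<noteq> 0)" "eval_pair B x \<noteq> 0 \<longleftrightarrow> (\<exists>i. dot (b i) x \<noteq> 0)"
    "eval_pair C x \<noteq> 0 \<longleftrightarrow> (\<exists>i. dot (c i) x \<noteq> 0)" for x
    by (simp_all add: eval_pair_def vec_eq_iff a b c)
  have F_0: "F 0 t u = 0" "F s 0 u = 0" "F s t 0 = 0" for s t u
    by (simp_all add: trilinear_def)
  have par: "parallel (eval_pair A (F s t u)) s \<and> parallel (eval_pair B (F s t u)) t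
      \<and> parallel (eval_pair C (F s t u)) u"
    if "dot (a i) (F s t u) \<noteq> 0" "dot (b j) (F s t u) \<noteq> 0" "dot (c k) (F s t u) \<noteq> 0" for s t u i j k
  proof -
    have "F s t u \<noteq> 0" using that(1) by auto
    moreover from this have "s \<noteq> 0" "t \<noteq> 0" "u \<noteq> 0" by (auto simp: F_0)
    ultimately show ?thesis
      using inv that unfolding inverse_rational_maps_def Let_def neq_0 same_point_iff_parallel by blast
  qed
  have par_iff: "parallel (eval_pair A x) s \<longleftrightarrow> s $ 1 * dot (a 0) x = s $ 0 * dot (a 1) x"
    "parallel (eval_pair B x) s \<longleftrightarrow> s $ 1 * dot (b 0) x = s $ 0 * dot (b 1) x"
    "parallel (eval_pair C x) s \<longleftrightarrow> s $ 1 * dot (c 0) x = s $ 0 * dot (c 1) x" for x s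
    by (auto simp: parallel_def forall_two eval_pair_def a b c algebra_simps)
  \<comment> \<open>Where both forms of a pair vanish its identity reads \<open>0 = 0\<close>, so
    each identity requires only the other two pairs to be nonzero.\<close>
  have vanish: "(\<exists>i. dot (d i) x \<noteq> 0) \<or> s $ 1 * dot (d 0) x = s $ 0 * dot (d 1) x"
    for d :: "2 \<Rightarrow> complex ^ 4" and x s
    by (metis mult_zero_right)
  obtain s' t' u' i' j' k' where w: "dot (a i') (F s' t' u') \<noteq> 0" "dot (b j') (F s' t' u') \<noteq> 0"
      "dot (c k') (F s' t' u') \<noteq> 0"
    using inv unfolding inverse_rational_maps_def Let_def neq_0 by blast
  let ?W = "\<lambda>i j k. v i j k / \<Delta> i j k"
  interpret R: hexahedron T U S "\<lambda>j k i. Q i j k" "\<lambda>j k i. v i j k"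
    by (rule rotated)
  interpret R2: hexahedron U S T "\<lambda>k i j. Q i j k" "\<lambda>k i j. v i j k"
    by (rule R.rotated)
  note rot = trilinear_rotate[of v Q] trilinear_rotate[of "\<lambda>j k i. v i j k" "\<lambda>j k i. Q i j k"]
    rotated_\<Delta> R.rotated_\<Delta>
  have a01: "s $ 1 * dot (a 0) (F s t u) = s $ 0 * dot (a 1) (F s t u)"
    if "dot (b j) (F s t u) \<noteq> 0" "dot (c k) (F s t u) \<noteq> 0" for s t u j k
    using par[OF _ that] par_iff(1) vanish[of a] by blast
  have b01: "t $ 1 * dot (b 0) (F s t u) = t $ 0 * dot (b 1) (F s t u)"
    if "dot (c k) (F s t u) \<noteq> 0" "dot (a i) (F s t u) \<noteq> 0" for s t u i k
    using par[OF that(2) _ that(1)] par_iff(2) vanish[of b] by blast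
  have c01: "u $ 1 * dot (c 0) (F s t u) = u $ 0 * dot (c 1) (F s t u)"
    if "dot (a i) (F s t u) \<noteq> 0" "dot (b j) (F s t u) \<noteq> 0" for s t u i j
    using par[OF that] par_iff(3) vanish[of c] by blast
  have "\<exists>\<rho>. \<forall>j k. ?W 1 j k = \<rho> * ?W 0 j k"
    by (rule slices_proportional_if_generic[of b c a, OF a01 w])
  then obtain \<rho>1 where 1: "\<And>j k. ?W 1 j k = \<rho>1 * ?W 0 j k"
    by blast
  have "\<exists>\<rho>. \<forall>k i. ?W i 1 k = \<rho> * ?W i 0 k"
    using R.slices_proportional_if_generic[of c a b, unfolded rot, OF b01 w(2,3,1)] .
  then obtain \<rho>2 where 2: "\<And>i k. ?W i 1 k = \<rho>2 * ?W i 0 k"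
    by blast
  have "\<exists>\<rho>. \<forall>i j. ?W i j 1 = \<rho> * ?W i j 0"
    using R2.slices_proportional_if_generic[of a b c, unfolded rot, OF c01 w(3,1,2)] .
  then obtain \<rho>3 where 3: "\<And>i j. ?W i j 1 = \<rho>3 * ?W i j 0"
    by blast
  \<comment> \<open>Every entry is \<open>?W 0 0 0\<close> times one ratio for each index equal to
    1.\<close>
  have "\<forall>i j k. ?W i j k * (?W 0 0 0)\<^sup>2 = ?W i 0 0 * ?W 0 j 0 * ?W 0 0 k"
    unfolding forall_two by (simp add: 1 2 3 power2_eq_square ac_simps)
  then show ?thesis by blast
qed

section \<open>From rank one to a linear inverse\<close>

lemma rank_one_imp_birational:
  assumes "\<And>i j k. v i j k / \<Delta> i j k = \<alpha> $ i * \<beta> $ j * \<gamma> $ k"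
  shows "birational_of_type F (1, 1, 1)"
proof -
  have vQ: "v i j k *s Q i j k = (\<alpha> $ i * \<beta> $ j * \<gamma> $ k) *s wedge (S i) (T j) (U k)" for i j k
    using assms[of i j k, symmetric] \<Delta>_neq_0[of i j k] by (simp add: wedge_eq)
  have "(v i j k * x * y * z) *s Q i j k
      = (\<alpha> $ i * x * (\<beta> $ j * y) * (\<gamma> $ k * z)) *s wedge (S i) (T j) (U k)" for i j k x y z
  proof -
    have "(v i j k * x * y * z) *s Q i j k = (x * y * z) *s (v i j k *s Q i j k)"
      by (simp add: ac_simps)
    then show ?thesis unfolding vQ by (simp add: ac_simps)
  qed
  then have F: "F s t u = wedge (blend \<alpha> S s) (blend \<beta> T t) (blend \<gamma> U u)" for s t u
    by (simp add: trilinear_def blend_def sum_two vec.scale_right_distrib ac_simps)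
  \<comment> \<open>All entries of the tensor are nonzero, and the diagonal entry
    \<open>i i i\<close> involves all three coordinates at \<open>i\<close>.\<close>
  have nz: "\<alpha> $ i \<noteq> 0" "\<beta> $ i \<noteq> 0" "\<gamma> $ i \<noteq> 0" for i
    using assms[of i i i] v_neq_0 \<Delta>_neq_0 by auto
  let ?A = "pencil \<alpha> S" and ?B = "pencil \<beta> T" and ?C = "pencil \<gamma> U"
  have "inverse_rational_maps F ?A ?B ?C"
  proof -
    \<comment> \<open>The vertex \<open>Q 0 0 0\<close>, up to its weight, witnesses that both
      compositions are defined somewhere.\<close>
    let ?e = "axis 0 1 :: complex ^ 2"
    let ?x = "F ?e ?e ?e"
    have par: "parallel (eval_pair ?A (F s t u)) s" "parallel (eval_pair ?B (F s t u)) t"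
      "parallel (eval_pair ?C (F s t u)) u" for s t u
      unfolding dot_blend_eq_0_iff[symmetric] F by simp_all
    \<comment> \<open>The point \<open>x\<close> lies on the three planes whose parameters are
      computed from it, hence is parallel to their wedge.\<close>
    have par': "parallel (F (eval_pair ?A x) (eval_pair ?B x) (eval_pair ?C x)) x" for x
      unfolding F by (subst parallel_commute, rule parallel_wedge)
        (simp_all add: dot_blend_eq_0_iff parallel_def)
    have e: "?e \<noteq> 0" by (metis axis_eq_0_iff zero_neq_one)
    have x: "?x = v 0 0 0 *s Q 0 0 0" by (simp add: trilinear_slice axis_one_nth)
    then have x0: "?x \<noteq> 0" using v_neq_0 Q_neq_0 by simp
    have "eval_pair ?A ?x $ 0 \<noteq> 0" "eval_pair ?B ?x $ 0 \<noteq> 0" "eval_pair ?C ?x $ 0 \<noteq> 0"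
      unfolding x eval_pencil using nz v_neq_0 dot_S_neq_0[of 0 1] dot_T_neq_0[of 0 1] dot_U_neq_0[of 0 1]
      by simp_all
    then have ne: "eval_pair ?A ?x \<noteq> 0" "eval_pair ?B ?x \<noteq> 0" "eval_pair ?C ?x \<noteq> 0"
      by auto
    obtain a b c where abc: "eval_pair ?A ?x = a *s ?e" "eval_pair ?B ?x = b *s ?e" "eval_pair ?C ?x = c *s ?e"
      using par[of ?e ?e ?e] e by (meson parallelE)
    then have "F (eval_pair ?A ?x) (eval_pair ?B ?x) (eval_pair ?C ?x) = (a * b * c) *s ?x"
      unfolding abc by (simp add: F blend_smult ac_simps)
    moreover have "a * b * c \<noteq> 0" using ne unfolding abc by auto
    ultimately have "F (eval_pair ?A ?x) (eval_pair ?B ?x) (eval_pair ?C ?x) \<noteq> 0" using x0 by simp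
    then show ?thesis
      unfolding inverse_rational_maps_def Let_def same_point_iff_parallel
      using par par' ne x0 e by blast
  qed
  moreover have "\<forall>i. homogeneous 1 (pencil \<delta> X i)" for \<delta> X
    unfolding pencil_def by (blast intro: homogeneous_linear_form)
  moreover have "no_common_factor (?A 0) (?A 1)" "no_common_factor (?B 0) (?B 1)"
    "no_common_factor (?C 0) (?C 1)"
    using nz S_neq_0 T_neq_0 U_neq_0 dot_Q[of 0 0 0] dot_Q(2)[of 0 0 0] dot_Q(3)[of 0 0 0]
      dot_S_neq_0[of 0 1 0 0] dot_T_neq_0[of 0 1 0 0] dot_U_neq_0[of 0 1 0 0]
    by (simp_all add: no_common_factor_pencil[where x = "Q 0 0 0"])
  ultimately show ?thesis
    unfolding birational_of_type_def by blast
qed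

end

section \<open>Boundary surfaces and lines\<close>

lemma plane_of_dot: "plane_of a = {x. x \<noteq> 0 \<and> dot a x = 0}"
  by (simp add: plane_of_def dot_def)

lemma plane_of_eq_if_parallel:
  assumes "parallel a b" "a \<noteq> 0" "b \<noteq> 0"
  shows "plane_of a = plane_of b"
proof -
  obtain c where "a = c *s b" by (rule parallelE[OF assms(1,3)])
  with assms(2) show ?thesis by (auto simp: plane_of_dot)
qed

lemma in_zariski_closure_points_of:
  assumes "x \<in> X" "x \<noteq> 0"
  shows "x \<in> zariski_closure (points_of X)"
proof -
  have "x \<in> points_of X"
    using assms by (auto simp: points_of_def same_point_iff_parallel parallel_def intro!: bexI[of _ x])
  then show ?thesis using assms(2) by (simp add: zariski_closure_def)
qed

text \<open>Parallel generators lie in the span of one vector, too small for a subspace of dimension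
  2.\<close>

lemma not_parallel_if_is_line:
  fixes x y :: "complex ^ 4"
  assumes "is_line (points_of {(s $ 0) *s x + (s $ 1) *s y | s. s \<noteq> (0 :: complex ^ 2)})"
  shows "\<not> parallel x y"
proof
  assume "parallel x y"
  then obtain z where z: "x \<in> vec.span {z}" "y \<in> vec.span {z}"
    using vec.span_base vec.span_scale vec.span_zero by (metis parallelE insertI1)
  obtain L where L: "vec.dim L = 2"
    "points_of {(s $ 0) *s x + (s $ 1) *s y | s. s \<noteq> (0 :: complex ^ 2)} = L - {0}"
    using assms by (auto simp: is_line_def)
  have "p \<in> vec.span {z}" if "p \<in> L" for p
  proof (cases "p = 0")
    case False
    then have "p \<in> points_of {(s $ 0) *s x + (s $ 1) *s y | s. s \<noteq> (0 :: complex ^ 2)}"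
      using L(2) that by blast
    then obtain c q where q: "q \<in> {(s $ 0) *s x + (s $ 1) *s y | s. s \<noteq> (0 :: complex ^ 2)}" and p: "p = c *s q"
      by (auto simp: points_of_def same_point_def simp del: vec.scale_right_distrib)
    from q obtain s :: "complex ^ 2" where "q = (s $ 0) *s x + (s $ 1) *s y"
      by blast
    with p have "p = c *s ((s $ 0) *s x + (s $ 1) *s y)"
      by simp
    then show ?thesis
      using z by (auto intro!: vec.span_scale vec.span_add)
  qed (simp add: vec.span_zero)
  then have "vec.dim L \<le> card {z}" by (intro vec.dim_le_card) auto
  with L(1) show False by simp
qed

text \<open>Both sides are the line in which the planes \<open>a\<close> and \<open>b\<close> meet;
  \<open>orthogonal_pair_span\<close> supplies the parameters of a point on it.\<close>

lemma points_of_span_pair: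
  fixes x y a b :: "complex ^ 4"
  assumes "\<not> parallel x y" "\<not> parallel a b"
    and "dot a x = 0" "dot a y = 0" "dot b x = 0" "dot b y = 0"
  shows "points_of {(s $ 0) *s x + (s $ 1) *s y | s. s \<noteq> (0 :: complex ^ 2)}
    = {z. z \<noteq> 0 \<and> dot a z = 0 \<and> dot b z = 0}" (is "?X = ?Y")
proof
  show "?X \<subseteq> ?Y"
    using assms by (auto simp: points_of_def same_point_def)
  show "?Y \<subseteq> ?X"
  proof
    fix z assume z: "z \<in> ?Y"
    then obtain c d where cd: "z = c *s x + d *s y"
      using orthogonal_pair_span[OF assms(2,1), of z] assms by auto
    define s :: "complex ^ 2" where "s = (\<chi> i. if i = 0 then c else d)"
    have s: "s $ 0 = c" "s $ 1 = d" by (simp_all add: s_def)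
    have "s \<noteq> 0" using s cd z by auto
    with s cd have "z \<in> {(s $ 0) *s x + (s $ 1) *s y | s. s \<noteq> (0 :: complex ^ 2)}" by blast
    then show "z \<in> ?X"
      using z by (auto simp: points_of_def same_point_def intro!: exI[of _ "1 :: complex"])
  qed
qed

lemma of_real_Delta: "complex_of_real (Delta a b c) = wedge (cvec a) (cvec b) (cvec c) $ 0"
  by (simp add: Delta_def det_3 wedge_nth minor_def cvec_def algebra_simps)

text \<open>The vectors are the three edges of the tensor at the entry \<open>0 0 0\<close>, which
  is nonzero; the surplus factor \<open>(W 0 0 0)\<^sup>2\<close> is absorbed into \<alpha>.\<close>

lemma rank_oneI:
  assumes "W 0 0 0 \<noteq> 0"
    and "\<And>i j k. W i j k * (W 0 0 0)\<^sup>2 = W i 0 0 * W 0 j 0 * W 0 0 k"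
  shows "rank_one W"
proof -
  define \<alpha> \<beta> \<gamma> :: "real ^ 2" where "\<alpha> = (\<chi> i. W i 0 0 / (W 0 0 0)\<^sup>2)"
    and "\<beta> = (\<chi> j. W 0 j 0)" and "\<gamma> = (\<chi> k. W 0 0 k)"
  have "\<alpha> \<noteq> 0" "\<beta> \<noteq> 0" "\<gamma> \<noteq> 0"
    using assms(1) by (auto simp: \<alpha>_def \<beta>_def \<gamma>_def vec_eq_iff)
  moreover have "W i j k = \<alpha> $ i * \<beta> $ j * \<gamma> $ k" for i j k
    using assms(2)[of i j k] assms(1) by (simp add: \<alpha>_def \<beta>_def \<gamma>_def field_simps)
  ultimately show ?thesis
    unfolding rank_one_def by blast
qed

text \<open>Edges being lines makes neighbouring vertices distinct and weights nonzero; closures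
  contain the vertices, which gives the incidences; distinctness of surfaces and edges puts the
  planes in general position.\<close>

lemma hexahedronI:
  assumes Q_0: "\<And>i j k. Q i j k $ 0 = 1"
    and nd: "nondegenerate (trilinear v Q)"
    and S: "\<And>i. surface_s (trilinear v Q) i = plane_of (S i)"
    and T: "\<And>j. surface_t (trilinear v Q) j = plane_of (T j)"
    and U: "\<And>k. surface_u (trilinear v Q) k = plane_of (U k)"
    and S_neq_0: "\<And>i. S i \<noteq> 0" and T_neq_0: "\<And>j. T j \<noteq> 0" and U_neq_0: "\<And>k. U k \<noteq> 0"
  shows "hexahedron S T U Q v"
proof -
  let ?f = "trilinear v Q"
  let ?span = "\<lambda>x y. points_of {(s $ 0) *s x + (s $ 1) *s y | s. s \<noteq> (0 :: complex ^ 2)}"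
  note rot = trilinear_rotate[of v Q, symmetric]
    trilinear_rotate[of "\<lambda>j k i. v i j k" "\<lambda>j k i. Q i j k", symmetric]
  have line_s: "line_s ?f j k = ?span (v 0 j k *s Q 0 j k) (v 1 j k *s Q 1 j k)" for j k
    by (simp add: line_s_def trilinear_slice)
  have line_t: "line_t ?f i k = ?span (v i 0 k *s Q i 0 k) (v i 1 k *s Q i 1 k)" for i k
    by (simp add: line_t_def rot(1) trilinear_slice)
  have line_u: "line_u ?f i j = ?span (v i j 0 *s Q i j 0) (v i j 1 *s Q i j 1)" for i j
    by (simp add: line_u_def trans[OF rot] trilinear_slice)
  have lines: "\<forall>j k. is_line (line_s ?f j k)" "\<forall>i k. is_line (line_t ?f i k)" "\<forall>i j. is_line (line_u ?f i j)"
    unfolding forall_two using nd by (simp_all add: nondegenerate_def boundary_lines_def)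
  have np_s: "\<not> parallel (v 0 j k *s Q 0 j k) (v 1 j k *s Q 1 j k)" for j k
    using not_parallel_if_is_line lines(1) unfolding line_s by blast
  have np_t: "\<not> parallel (v i 0 k *s Q i 0 k) (v i 1 k *s Q i 1 k)" for i k
    using not_parallel_if_is_line lines(2) unfolding line_t by blast
  have np_u: "\<not> parallel (v i j 0 *s Q i j 0) (v i j 1 *s Q i j 1)" for i j
    using not_parallel_if_is_line lines(3) unfolding line_u by blast
  have parallel_self: "parallel (a *s x) (b *s x)" for a b and x :: "complex ^ 4"
    by (simp add: parallel_def)
  have Q_distinct: "Q 0 j k \<noteq> Q 1 j k" "Q i 0 k \<noteq> Q i 1 k" "Q i j 0 \<noteq> Q i j 1" for i j k
    using np_s[of j k] np_t[of i k] np_u[of i j] parallel_self by metis+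
  \<comment> \<open>A zero weight would give the zero vector, which is parallel to
    everything.\<close>
  have "\<forall>i. v i j k \<noteq> 0" for j k
    unfolding forall_two using np_s[of j k] by auto
  then have v_neq_0: "v i j k \<noteq> 0" for i j k by blast
  have f_axis: "?f (axis i 1) (axis j 1) (axis k 1) = v i j k *s Q i j k" for i j k
  proof -
    have "\<forall>i. ?f (axis i 1) (axis j 1) (axis k 1) = v i j k *s Q i j k"
      unfolding forall_two by (simp add: trilinear_slice axis_one_nth)
    then show ?thesis by blast
  qed
  have vQ_neq_0: "v i j k *s Q i j k \<noteq> 0" for i j k
    using v_neq_0[of i j k] Q_0[of i j k] by auto
  have axis_neq_0: "axis i 1 \<noteq> (0 :: complex ^ 2)" for i
    by (simp add: axis_eq_0_iff)
  have "v i j k *s Q i j k \<in> plane_of (S i)" "v i j k *s Q i j k \<in> plane_of (T j)"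
    "v i j k *s Q i j k \<in> plane_of (U k)" for i j k
    unfolding S[symmetric] T[symmetric] U[symmetric] surface_s_def surface_t_def surface_u_def
    by (rule in_zariski_closure_points_of[OF _ vQ_neq_0],
        use f_axis[of i j k, symmetric] axis_neq_0 in blast)+
  then have dot_Q: "dot (S i) (Q i j k) = 0" "dot (T j) (Q i j k) = 0" "dot (U k) (Q i j k) = 0" for i j k
    using v_neq_0 by (auto simp: plane_of_dot)
  have "\<forall>i j. surface_s ?f i \<noteq> surface_t ?f j" "\<forall>i k. surface_s ?f i \<noteq> surface_u ?f k"
    "\<forall>i j k. line_t ?f i k \<noteq> line_u ?f i j"
    unfolding forall_two using nd by (simp_all add: nondegenerate_def boundary_surfaces_def boundary_lines_def)
  then have ST: "\<not> parallel (S i) (T j)" and SU: "\<not> parallel (S i) (U k)"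
    and tu: "line_t ?f i k \<noteq> line_u ?f i j" for i j k
    using plane_of_eq_if_parallel S_neq_0 T_neq_0 U_neq_0 unfolding S T U by blast+
  \<comment> \<open>Otherwise the three planes belong to one pencil. Then \<open>S i\<close> meets
    \<open>T j\<close> and \<open>U k\<close> in the same line, which is both a
    \<open>u\<close>-edge and a \<open>t\<close>-edge, although these are distinct.\<close>
  have "wedge (S i) (T j) (U k) \<noteq> 0" for i j k
  proof
    assume *: "wedge (S i) (T j) (U k) = 0"
    then obtain x y where 1: "U k = x *s S i + y *s T j"
      using wedge_eq_0_imp_span ST by blast
    have "wedge (S i) (U k) (T j) = 0"
      using * wedge_swap[of "S i" "U k" "T j"]
      by (simp add: wedge_rotate[of "S i" "T j" "U k"] wedge_rotate[of "U k" "S i" "T j", symmetric])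
    then obtain x' y' where 2: "T j = x' *s S i + y' *s U k"
      using wedge_eq_0_imp_span SU by blast
    have "line_u ?f i j = {z. z \<noteq> 0 \<and> dot (S i) z = 0 \<and> dot (T j) z = 0}"
      unfolding line_u using np_u ST by (intro points_of_span_pair) (simp_all add: dot_Q)
    also have "\<dots> = {z. z \<noteq> 0 \<and> dot (S i) z = 0 \<and> dot (U k) z = 0}"
      using arg_cong[OF 1, of "\<lambda>a. dot a z" for z] arg_cong[OF 2, of "\<lambda>a. dot a z" for z]
      by auto
    also have "\<dots> = line_t ?f i k"
      unfolding line_t using np_t SU by (intro points_of_span_pair[symmetric]) (simp_all add: dot_Q)
    finally show False using tu by metis
  qed
  with Q_0 dot_Q Q_distinct v_neq_0 show ?thesis
    by unfold_locales
qed

theorem theorem3p5: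
  fixes P :: "2 \<Rightarrow> 2 \<Rightarrow> 2 \<Rightarrow> real ^ 4"
    and w :: "2 \<Rightarrow> 2 \<Rightarrow> 2 \<Rightarrow> real"
    and \<sigma> \<tau> \<upsilon> :: "2 \<Rightarrow> real ^ 4"
  assumes "\<And>i j k. P i j k $ 0 = 1"
    and "nondegenerate (trilinear_map P w)"
    and "hexahedral (trilinear_map P w)"
    and "\<And>i. surface_s (trilinear_map P w) i = plane_of (cvec (\<sigma> i))"
    and "\<And>j. surface_t (trilinear_map P w) j = plane_of (cvec (\<tau> j))"
    and "\<And>k. surface_u (trilinear_map P w) k = plane_of (cvec (\<upsilon> k))"
  shows "birational_of_type (trilinear_map P w) (1, 1, 1) \<longleftrightarrow>
         rank_one (\<lambda>i j k. w i j k / Delta (\<sigma> i) (\<tau> j) (\<upsilon> k))"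
proof -
  let ?f = "trilinear_map P w" and ?W = "\<lambda>i j k. w i j k / Delta (\<sigma> i) (\<tau> j) (\<upsilon> k)"
  let ?Q = "\<lambda>i j k. cvec (P i j k)" and ?v = "\<lambda>i j k. complex_of_real (w i j k)"
  have f: "?f = trilinear ?v ?Q"
    by (simp add: fun_eq_iff trilinear_map_def trilinear_def)
  \<comment> \<open>A zero coefficient vector would make \<open>plane_of\<close> the whole space;
    that boundary surfaces are planes excludes this.\<close>
  have not_plane_0: "\<not> is_plane (plane_of 0)"
  proof
    assume "is_plane (plane_of 0)"
    then obtain a :: "complex ^ 4" where a: "a \<noteq> 0" "plane_of 0 = plane_of a"
      by (auto simp: is_plane_def)
    have "axis i 1 \<in> plane_of (0 :: complex ^ 4)" for i
      by (simp add: plane_of_dot axis_eq_0_iff)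
    then have "a $ i = 0" for i
      unfolding a(2) by (simp add: plane_of_dot)
    with a(1) show False by (simp add: vec_eq_iff)
  qed
  have "\<forall>i. is_plane (surface_s ?f i)" "\<forall>j. is_plane (surface_t ?f j)" "\<forall>k. is_plane (surface_u ?f k)"
    unfolding forall_two using assms(3) by (simp_all add: hexahedral_def boundary_surfaces_def)
  then have "cvec (\<sigma> i) \<noteq> 0" "cvec (\<tau> i) \<noteq> 0" "cvec (\<upsilon> i) \<noteq> 0" for i
    unfolding assms(4-6) using not_plane_0 by metis+
  then interpret hexahedron "\<lambda>i. cvec (\<sigma> i)" "\<lambda>j. cvec (\<tau> j)" "\<lambda>k. cvec (\<upsilon> k)" ?Q ?v
    using assms(1,2,4-6) unfolding f by (intro hexahedronI) (simp_all add: cvec_def)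
  have W: "?v i j k / \<Delta> i j k = complex_of_real (?W i j k)" for i j k
    by (simp add: \<Delta>_def of_real_Delta)
  have W_neq_0: "?W 0 0 0 \<noteq> 0"
    using v_neq_0[of 0 0 0] \<Delta>_neq_0[of 0 0 0] by (simp add: \<Delta>_def flip: of_real_Delta)
  show ?thesis
  proof
    assume "birational_of_type ?f (1, 1, 1)"
    from birational_imp_rank_one[OF this[unfolded f]]
    have "?W i j k * (?W 0 0 0)\<^sup>2 = ?W i 0 0 * ?W 0 j 0 * ?W 0 0 k" for i j k
      unfolding W by (simp only: of_real_eq_iff flip: of_real_mult of_real_power)
    then show "rank_one ?W"
      using rank_oneI[of ?W] W_neq_0 by blast
  next
    assume "rank_one ?W"
    then obtain \<alpha> \<beta> \<gamma> :: "real ^ 2" where abc: "\<And>i j k. ?W i j k = \<alpha> $ i * \<beta> $ j * \<gamma> $ k"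
      unfolding rank_one_def by blast
    show "birational_of_type ?f (1, 1, 1)"
      unfolding f
      by (rule rank_one_imp_birational[of "cvec \<alpha>" "cvec \<beta>" "cvec \<gamma>"])
        (simp only: W abc, simp add: cvec_def)
  qed
qed

end
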